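(* Let $d<\infty$, let $V\subset\mathbb{B}_d$ be an analytic disc attached to the unit sphere and $f$ its embedding map. Suppose $f(\xi)=f(\zeta)$ for two distinct $\xi,\zeta\in\mathbb{T}$. If $h\in\mathcal{H}_f$ extends continuously to $\overline{\mathbb{D}}$, then $h(\xi)=h(\zeta)$.
   Context: $\mathbb{D}$ is the open unit disc, $\mathbb{T}$ the unit circle, $\mathbb{B}_d$ the open unit ball of $\mathbb{C}^d$. The Drury–Arveson space $H^2_d$ is the RKHS on $\mathbb{B}_d$ with kernel $1/(1-\langle z,w\rangle)$, with multiplier algebra $\mathcal{M}_d$. A variety is a common zero set in $\mathbb{B}_d$ of a family of functions from $\mathcal{M}_d$. An analytic disc attached to the unit sphere is a variety $V\subset\mathbb{B}_d$ ($d<\infty$) for which there is an injective analytic $f:\mathbb{D}\to\mathbb{B}_d$ with $f'(z)\neq0$ on $\mathbb{D}$, $V=f(\mathbb{D})$, $f$ extends to a $C^2$ map on $\overline{\mathbb{D}}$, and for $x\in\overline{\mathbb{D}}$, $\|f(x)\|=1$ iff $|x|=1$ ($f$ is the embedding map). $\mathcal{H}_f$ is the RKHS on $\mathbb{D}$ with kernel $k^f(z,w)=1/(1-\langle f(z),f(w)\rangle)$. *)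

theory Defs
  imports "HOL-Analysis.Analysis"
begin

definition cinner :: "complex^'n::finite \<Rightarrow> complex^'n \<Rightarrow> complex" where
  "cinner z w = (\<Sum>i\<in>UNIV. z$i * cnj (w$i))"

text \<open>Membership in the reproducing kernel Hilbert space on X with kernel K
 (Aronszajn's characterization: h is in H(K) iff C K(x,y) - h(x) conj(h(y)) is a
 positive kernel for some C).\<close>
definition in_rkhs :: "'a set \<Rightarrow> ('a \<Rightarrow> 'a \<Rightarrow> complex) \<Rightarrow> ('a \<Rightarrow> complex) \<Rightarrow> bool" where
  "in_rkhs X K h \<longleftrightarrow> (\<exists>C::real. \<forall>F a. finite F \<longrightarrow> F \<subseteq> X \<longrightarrow>
     (cmod (\<Sum>x\<in>F. a x * h x))\<^sup>2 \<le> C * Re (\<Sum>x\<in>F. \<Sum>y\<in>F. a x * cnj (a y) * K x y))"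

definition DA_kernel :: "complex^'n::finite \<Rightarrow> complex^'n \<Rightarrow> complex" where
  "DA_kernel z w = 1 / (1 - cinner z w)"

definition in_DA :: "(complex^'n::finite \<Rightarrow> complex) \<Rightarrow> bool" where
  "in_DA h \<longleftrightarrow> in_rkhs (ball 0 1) DA_kernel h"

definition DA_multiplier :: "(complex^'n::finite \<Rightarrow> complex) \<Rightarrow> bool" where
  "DA_multiplier \<phi> \<longleftrightarrow> (\<forall>h. in_DA h \<longrightarrow> in_DA (\<lambda>z. \<phi> z * h z))"

definition DA_variety :: "(complex^'n::finite) set \<Rightarrow> bool" where
  "DA_variety V \<longleftrightarrow> (\<exists>S. (\<forall>\<phi>\<in>S. DA_multiplier \<phi>) \<and>
      V = {z \<in> ball 0 1. \<forall>\<phi>\<in>S. \<phi> z = 0})"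

definition C2_on :: "complex set \<Rightarrow> (complex \<Rightarrow> 'b::real_normed_vector) \<Rightarrow> bool" where
  "C2_on U F \<longleftrightarrow> (\<exists>F' F''. (\<forall>x\<in>U. (F has_derivative blinfun_apply (F' x)) (at x)) \<and>
      (\<forall>x\<in>U. (F' has_derivative blinfun_apply (F'' x)) (at x)) \<and> continuous_on U F'')"

definition embedding_map :: "(complex \<Rightarrow> complex^'n::finite) \<Rightarrow> bool" where
  "embedding_map f \<longleftrightarrow>
     DA_variety (f ` ball 0 1) \<and>
     inj_on f (ball 0 1) \<and>
     (\<forall>i. (\<lambda>z. f z $ i) holomorphic_on ball 0 1) \<and>
     (\<forall>z\<in>ball 0 1. \<exists>i. deriv (\<lambda>w. f w $ i) z \<noteq> 0) \<and>
     (\<exists>U F. open U \<and> cball 0 1 \<subseteq> U \<and> C2_on U F \<and> (\<forall>x\<in>cball 0 1. F x = f x)) \<and>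
     (\<forall>x\<in>cball 0 1. norm (f x) = 1 \<longleftrightarrow> cmod x = 1)"

definition in_Hf :: "(complex \<Rightarrow> complex^'n::finite) \<Rightarrow> (complex \<Rightarrow> complex) \<Rightarrow> bool" where
  "in_Hf f h \<longleftrightarrow> in_rkhs (ball 0 1) (\<lambda>z w. 1 / (1 - cinner (f z) (f w))) h"

end

theory Submission
  imports Defs "HOL-Complex_Analysis.Conformal_Mappings"
begin

text \<open>Let \<open>p = f \<xi> = f \<zeta>\<close>. Along suitably scaled radii \<open>z\<^sub>t \<longlongrightarrow> \<xi>\<close> and
  \<open>w\<^sub>t \<longlongrightarrow> \<zeta>\<close> one has \<open>f z\<^sub>t = p - t u + O(t\<^sup>2)\<close> and \<open>f w\<^sub>t = p - t v + O(t\<^sup>2)\<close>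
  with \<open>u\<close> and \<open>v\<close> both pairing to 1 with \<open>p\<close>. Hence all four kernel values
  on \<open>{z\<^sub>t, w\<^sub>t}\<close> equal \<open>1 / (2 t) + O(1)\<close>, so the differences of the kernel functions
  at \<open>z\<^sub>t\<close> and \<open>w\<^sub>t\<close> stay bounded although each of them blows up. As \<open>f \<xi> = f \<zeta>\<close>, these
  differences tend to 0 on every kernel function, thus weakly, and
  \<open>h z\<^sub>t - h w\<^sub>t \<longlongrightarrow> 0\<close> for every \<open>h\<close> in the space.\<close>

section \<open>The Hermitian form on complex n-space\<close>

lemma cinner_add_left: "cinner (x + y) z = cinner x z + cinner y z"
  and cinner_diff_left: "cinner (x - y) z = cinner x z - cinner y z"
  and cinner_add_right: "cinner x (y + z) = cinner x y + cinner x z"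
  and cinner_diff_right: "cinner x (y - z) = cinner x y - cinner x z"
  by (simp_all add: cinner_def sum.distrib sum_subtractf algebra_simps)

lemma cinner_scaleR_left: "cinner (r *\<^sub>R x) y = r *\<^sub>R cinner x y"
  and cinner_scaleR_right: "cinner x (r *\<^sub>R y) = r *\<^sub>R cinner x y"
  by (simp_all add: cinner_def scaleR_sum_right)

lemma cnj_cinner: "cnj (cinner x y) = cinner y x"
  by (simp add: cinner_def mult.commute)

lemma Re_cinner: "Re (cinner x y) = x \<bullet> y"
  by (simp add: cinner_def inner_vec_def inner_complex_def)

lemma cinner_self: "cinner x x = of_real ((norm x)\<^sup>2)"
proof -
  have "Im (cinner x x) = 0"
    using arg_cong[OF cnj_cinner[of x x], of Im] by simp
  then show ?thesis
    by (intro complex_eqI) (simp_all add: Re_cinner power2_norm_eq_inner)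
qed

lemma norm_cinner_le: "cmod (cinner x y) \<le> norm x * norm y"
proof -
  have "cmod (cinner x y) \<le> (\<Sum>i\<in>UNIV. \<bar>norm (x $ i)\<bar> * \<bar>norm (y $ i)\<bar>)"
    unfolding cinner_def by (rule order_trans[OF norm_sum]) (simp add: norm_mult)
  also have "\<dots> \<le> norm x * norm y"
    unfolding norm_vec_def by (rule L2_set_mult_ineq)
  finally show ?thesis .
qed

text \<open>Keeps the denominators of the kernel functions away from zero even when the second
  argument reaches the sphere, which is the limit case needed at \<open>p\<close>.\<close>

lemma cinner_neq_1:
  assumes "norm x < 1" and "norm y \<le> 1"
  shows "cinner x y \<noteq> 1"
proof
  assume "cinner x y = 1"
  then have "1 \<le> norm x * norm y"
    using norm_cinner_le[of x y] by simp
  also have "\<dots> \<le> norm x * 1"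
    using assms(2) by (intro mult_left_mono) auto
  finally show False using assms(1) by simp
qed

lemma bounded_bilinear_cinner: "bounded_bilinear cinner"
proof
  show "\<exists>K. \<forall>a b. norm (cinner a b) \<le> norm a * norm b * K"
    by (metis mult.right_neutral norm_cinner_le)
qed (simp_all add: cinner_add_left cinner_add_right cinner_scaleR_left cinner_scaleR_right)

section \<open>Positive kernels and weakly null differences of kernel functions\<close>

text \<open>Membership is defined by testing on sets of distinct points. Grouping the coefficients
  that sit over the same point allows families with repetitions, so the sequences used later need
  not be injective or disjoint.\<close>

lemma in_rkhs_indexed:
  assumes "in_rkhs X K h"
  obtains C where "C \<ge> 0" and
    "\<And>I p c. finite I \<Longrightarrow> p ` I \<subseteq> X \<Longrightarrow>
      (cmod (\<Sum>i\<in>I. c i * h (p i)))\<^sup>2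
        \<le> C * cmod (\<Sum>i\<in>I. \<Sum>j\<in>I. c i * cnj (c j) * K (p i) (p j))"
proof -
  obtain C :: real where C: "\<And>F a. finite F \<Longrightarrow> F \<subseteq> X \<Longrightarrow>
     (cmod (\<Sum>x\<in>F. a x * h x))\<^sup>2 \<le> C * Re (\<Sum>x\<in>F. \<Sum>y\<in>F. a x * cnj (a y) * K x y)"
    using assms unfolding in_rkhs_def by blast
  have "(cmod (\<Sum>i\<in>I. c i * h (p i)))\<^sup>2
      \<le> \<bar>C\<bar> * cmod (\<Sum>i\<in>I. \<Sum>j\<in>I. c i * cnj (c j) * K (p i) (p j))"
    if I: "finite I" "p ` I \<subseteq> X" for I and p :: "'b \<Rightarrow> 'a" and c
  proof -
    define a where "a = (\<lambda>x. \<Sum>i\<in>{i\<in>I. p i = x}. c i)"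
    have collapse: "(\<Sum>i\<in>I. c i * q (p i)) = (\<Sum>x\<in>p ` I. a x * q x)" for q
      using I(1) by (subst sum.image_gen[where g = p])
        (auto simp: a_def sum_distrib_right intro!: sum.cong)
    have collapse_cnj: "(\<Sum>i\<in>I. cnj (c i) * q (p i)) = (\<Sum>x\<in>p ` I. cnj (a x) * q x)" for q
      using I(1) by (subst sum.image_gen[where g = p])
        (auto simp: a_def sum_distrib_right intro!: sum.cong)
    have "(\<Sum>i\<in>I. \<Sum>j\<in>I. c i * cnj (c j) * K (p i) (p j))
        = (\<Sum>i\<in>I. c i * (\<Sum>j\<in>I. cnj (c j) * K (p i) (p j)))"
      by (simp add: sum_distrib_left mult.assoc)
    also have "\<dots> = (\<Sum>i\<in>I. c i * (\<Sum>y\<in>p ` I. cnj (a y) * K (p i) y))"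
      using collapse_cnj by simp
    also have "\<dots> = (\<Sum>x\<in>p ` I. \<Sum>y\<in>p ` I. a x * cnj (a y) * K x y)"
      by (subst collapse) (simp add: sum_distrib_left mult.assoc)
    finally have E: "(\<Sum>i\<in>I. \<Sum>j\<in>I. c i * cnj (c j) * K (p i) (p j))
        = (\<Sum>x\<in>p ` I. \<Sum>y\<in>p ` I. a x * cnj (a y) * K x y)" .
    have "(cmod (\<Sum>i\<in>I. c i * h (p i)))\<^sup>2
        \<le> C * Re (\<Sum>i\<in>I. \<Sum>j\<in>I. c i * cnj (c j) * K (p i) (p j))"
      unfolding collapse E using C I by simp
    also have "\<dots> \<le> \<bar>C\<bar> * cmod (\<Sum>i\<in>I. \<Sum>j\<in>I. c i * cnj (c j) * K (p i) (p j))"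
      by (rule order_trans[OF abs_ge_self], unfold abs_mult abs_idempotent)
        (intro mult_left_mono abs_Re_le_cmod abs_ge_zero)
    finally show ?thesis .
  qed
  then show thesis by (intro that[of "\<bar>C\<bar>"]) auto
qed

text \<open>Greedy choice: every row of the Gram matrix \<open>G\<close> tends to zero, so a
  sufficiently late index is almost orthogonal to the finitely many chosen before. Symmetry of the
  norms covers the opposite order.\<close>

lemma almost_orthogonal_subset:
  fixes G :: "nat \<Rightarrow> nat \<Rightarrow> 'a::real_normed_vector"
  assumes "\<And>m. (\<lambda>n. G m n) \<longlonglongrightarrow> 0" and "\<And>m n. norm (G m n) = norm (G n m)" and "e > 0"
  shows "\<exists>S. finite S \<and> card S = N \<and> S \<subseteq> {n0..} \<and> (\<forall>i\<in>S. \<forall>j\<in>S. i \<noteq> j \<longrightarrow> norm (G i j) \<le> e)"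
proof (induction N)
  case 0
  show ?case by (rule exI[of _ "{}"]) simp
next
  case (Suc N)
  then obtain S where S: "finite S" "card S = N" "S \<subseteq> {n0..}"
    "\<And>i j. i \<in> S \<Longrightarrow> j \<in> S \<Longrightarrow> i \<noteq> j \<Longrightarrow> norm (G i j) \<le> e" by blast
  have "\<forall>\<^sub>F n in sequentially. norm (G i n) \<le> e" for i
    using tendstoD[OF assms(1)[of i] assms(3)] by (rule eventually_mono) simp
  then have "\<forall>\<^sub>F n in sequentially. \<forall>i\<in>S. norm (G i n) \<le> e"
    using S(1) by (simp add: eventually_ball_finite)
  then have "\<forall>\<^sub>F n in sequentially. (\<forall>i\<in>S. norm (G i n) \<le> e) \<and> n \<ge> n0 \<and> n > Max (insert 0 S)"
    by (intro eventually_conj eventually_ge_at_top eventually_gt_at_top)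
  then obtain n where n: "\<forall>i\<in>S. norm (G i n) \<le> e" "n \<ge> n0" "n > Max (insert 0 S)"
    by (metis (mono_tags, lifting) eventually_at_top_linorder order_refl)
  have "n \<notin> S"
    using n(3) S(1) by (metis Max_ge finite_insert insertCI leD)
  moreover have "norm (G n i) \<le> e" if "i \<in> S" for i
    using n(1) that assms(2)[of n i] by simp
  ultimately show ?case
    using S n(1,2) by (intro exI[of _ "insert n S"]) auto
qed

text \<open>The functionals \<open>q \<mapsto> q (z n) - q (w n)\<close> are bounded and tend to zero on the kernel
  functions, hence weakly; averaging them over almost orthogonal subsets makes this
  visible in the positivity condition.\<close>
lemma in_rkhs_diff_limit_zero:
  fixes z w :: "nat \<Rightarrow> 'a"
  assumes h: "in_rkhs X K h"
    and herm: "\<And>x y. K y x = cnj (K x y)"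
    and zX: "\<And>n. z n \<in> X" and wX: "\<And>n. w n \<in> X"
    and bdd: "\<And>n. cmod (K (z n) (z n) - K (z n) (w n) - K (w n) (z n) + K (w n) (w n)) \<le> M"
    and lim: "\<And>x. x \<in> X \<Longrightarrow> (\<lambda>n. K x (z n) - K x (w n)) \<longlonglongrightarrow> 0"
    and L: "(\<lambda>n. h (z n) - h (w n)) \<longlonglongrightarrow> L"
  shows "L = 0"
proof (rule ccontr)
  assume "L \<noteq> 0"
  define G where "G = (\<lambda>m n. K (z m) (z n) - K (z m) (w n) - K (w m) (z n) + K (w m) (w n))"
  have G_herm: "G n m = cnj (G m n)" for m n
    by (simp add: G_def herm[symmetric])
  then have G_norm: "cmod (G m n) = cmod (G n m)" for m n
    by (metis complex_mod_cnj)
  have G0: "(\<lambda>n. G m n) \<longlonglongrightarrow> 0" for m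
    using tendsto_diff[OF lim[OF zX[of m]] lim[OF wX[of m]]] by (simp add: G_def algebra_simps)
  obtain C where "C \<ge> 0" and C: "\<And>(I :: (nat \<times> bool) set) p c. finite I \<Longrightarrow> p ` I \<subseteq> X \<Longrightarrow>
      (cmod (\<Sum>i\<in>I. c i * h (p i)))\<^sup>2
        \<le> C * cmod (\<Sum>i\<in>I. \<Sum>j\<in>I. c i * cnj (c j) * K (p i) (p j))"
    by (rule in_rkhs_indexed[OF h, where 'b = "nat \<times> bool"]) blast
  have C': "(cmod (\<Sum>n\<in>S. h (z n) - h (w n)))\<^sup>2 \<le> C * cmod (\<Sum>m\<in>S. \<Sum>n\<in>S. G m n)"
    if "finite S" for S
  proof -
    \<comment> \<open>The tag \<open>True\<close> marks \<open>z n\<close> with coefficient 1 and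
      \<open>False\<close> marks \<open>w n\<close> with coefficient -1, which turns the kernel form
      into the Gram sum of the differences.\<close>
    define p where "p = (\<lambda>(n, b). if b then z n else w n)"
    define c :: "nat \<times> bool \<Rightarrow> complex" where "c = (\<lambda>(n, b). if b then 1 else -1)"
    have "(\<Sum>i\<in>S \<times> UNIV. c i * h (p i)) = (\<Sum>n\<in>S. h (z n) - h (w n))"
      by (simp add: UNIV_bool p_def c_def sum.cartesian_product')
    moreover have "(\<Sum>i\<in>S \<times> UNIV. \<Sum>j\<in>S \<times> UNIV. c i * cnj (c j) * K (p i) (p j))
        = (\<Sum>m\<in>S. \<Sum>n\<in>S. G m n)"
      by (simp add: sum.cartesian_product' UNIV_bool p_def c_def G_def
          sum.distrib sum_subtractf sum_negf algebra_simps)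
    ultimately show ?thesis
      using C[of "S \<times> UNIV" p c] that zX wX by (auto simp: p_def image_subset_iff)
  qed
  have "M \<ge> 0" using bdd[of 0] norm_ge_zero order_trans by blast
  obtain n0 where n0: "\<And>n. n \<ge> n0 \<Longrightarrow> cmod (h (z n) - h (w n) - L) \<le> cmod L / 2"
    using LIMSEQ_D[OF L, of "cmod L / 2"] \<open>L \<noteq> 0\<close> by (metis half_gt_zero_iff less_eq_real_def zero_less_norm_iff)
  \<comment> \<open>Over \<open>N\<close> almost orthogonal indices the functional values add up to
    at least \<open>N * cmod L / 2\<close>, whose square is quadratic in \<open>N\<close>. The Gram
    sum is only linear in \<open>N\<close>, so \<open>N\<close> stays bounded unless
    \<open>L\<close> vanishes.\<close>
  have est: "(cmod L / 2)\<^sup>2 * real N \<le> C * (M + 1)" if N: "N > 0" for N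
  proof -
    obtain S where S: "finite S" "card S = N" "S \<subseteq> {n0..}"
      "\<And>i j. i \<in> S \<Longrightarrow> j \<in> S \<Longrightarrow> i \<noteq> j \<Longrightarrow> cmod (G i j) \<le> 1 / N"
      using almost_orthogonal_subset[of G "1 / N" N n0, OF G0 G_norm] N
      by (metis of_nat_0_less_iff zero_less_divide_1_iff)
    have "cmod (\<Sum>n\<in>S. h (z n) - h (w n) - L) \<le> (\<Sum>n\<in>S. cmod L / 2)"
      using S(3) n0 by (intro sum_norm_le) auto
    then have "cmod ((\<Sum>n\<in>S. h (z n) - h (w n)) - N * L) \<le> N * (cmod L / 2)"
      using S(2) by (simp add: sum_subtractf)
    moreover have "cmod (N * L) = N * cmod L" by (simp add: norm_mult)
    ultimately have low: "N * (cmod L / 2) \<le> cmod (\<Sum>n\<in>S. h (z n) - h (w n))"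
      using norm_triangle_ineq3[of "\<Sum>n\<in>S. h (z n) - h (w n)" "N * L"] by argo
    have "cmod (\<Sum>m\<in>S. \<Sum>n\<in>S. G m n) \<le> (\<Sum>m\<in>S. M + 1)"
    proof (rule sum_norm_le)
      fix m assume m: "m \<in> S"
      \<comment> \<open>The diagonal entry costs \<open>M\<close>, and the threshold
        \<open>1 / N\<close> lets the other entries of the row cost at most 1 in total.\<close>
      have "cmod (\<Sum>n\<in>S. G m n) \<le> (\<Sum>n\<in>S. (if n = m then M else 0) + 1 / N)"
        using S(4) m bdd[of m] by (intro sum_norm_le) (auto simp: G_def intro: add_increasing2)
      also have "\<dots> = M + 1"
        using S(1,2) m N by (simp add: sum.distrib)
      finally show "cmod (\<Sum>n\<in>S. G m n) \<le> M + 1" .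
    qed
    then have up: "cmod (\<Sum>m\<in>S. \<Sum>n\<in>S. G m n) \<le> N * (M + 1)"
      using S(2) by simp
    have "(N * (cmod L / 2))\<^sup>2 \<le> (cmod (\<Sum>n\<in>S. h (z n) - h (w n)))\<^sup>2"
      using low by (intro power_mono) auto
    also have "\<dots> \<le> C * (N * (M + 1))"
      using C'[OF S(1)] mult_left_mono[OF up \<open>C \<ge> 0\<close>] by linarith
    finally have "N * ((cmod L / 2)\<^sup>2 * N) \<le> N * (C * (M + 1))"
      by (simp add: power2_eq_square mult_ac)
    then show ?thesis using N by simp
  qed
  obtain N where N: "real N > C * (M + 1) / (cmod L / 2)\<^sup>2"
    using reals_Archimedean2 by blast
  have "C * (M + 1) / (cmod L / 2)\<^sup>2 \<ge> 0"
    using \<open>C \<ge> 0\<close> \<open>M \<ge> 0\<close> by simp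
  then have "N > 0" using N by (metis of_nat_0_less_iff order_le_less_trans)
  moreover have "C * (M + 1) < (cmod L / 2)\<^sup>2 * N"
    using N \<open>L \<noteq> 0\<close> by (simp add: field_simps)
  ultimately show False using est[of N] by linarith
qed

section \<open>Boundary growth of disc maps and second-order expansion\<close>

text \<open>A disc automorphism moves \<open>\<psi> 0\<close> to 0, and the Schwarz lemma applies to
  the composite \<open>q\<close>. The identity \<open>ident\<close> converts
  \<open>cmod (q z) \<le> cmod z\<close> into a comparison of distances to the circle.\<close>

lemma Schwarz_Pick_boundary_growth:
  assumes holo: "\<psi> holomorphic_on ball 0 1" and bound: "\<And>z. cmod z < 1 \<Longrightarrow> cmod (\<psi> z) < 1"
  obtains c where "c > 0" and "\<And>z. cmod z < 1 \<Longrightarrow> c * (1 - cmod z) \<le> 1 - cmod (\<psi> z)"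
proof -
  define a where "a = \<psi> 0"
  define q where "q = (\<lambda>z. (\<psi> z - a) / (1 - cnj a * \<psi> z))"
  have a: "cmod a < 1" using bound by (simp add: a_def)
  have ident: "(cmod (1 - cnj a * s))\<^sup>2 - (cmod (s - a))\<^sup>2 = (1 - (cmod a)\<^sup>2) * (1 - (cmod s)\<^sup>2)" for s
    unfolding cmod_power2 by (simp add: power2_eq_square algebra_simps)
  have low: "1 - cmod a \<le> cmod (1 - cnj a * s)" if "cmod s < 1" for s
  proof -
    have "cmod (cnj a * s) \<le> cmod a"
      using that by (simp add: norm_mult mult_left_le)
    then show ?thesis
      using norm_triangle_ineq2[of 1 "cnj a * s"] by simp
  qed
  have nz: "1 - cnj a * \<psi> z \<noteq> 0" if "cmod z < 1" for z
    using low[OF bound[OF that]] a by auto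
  have "q holomorphic_on ball 0 1"
    unfolding q_def using nz by (intro holomorphic_intros holo) auto
  moreover have "q 0 = 0" by (simp add: q_def a_def)
  moreover have "cmod (q z) < 1" if "cmod z < 1" for z
  proof -
    have "(1 - (cmod a)\<^sup>2) * (1 - (cmod (\<psi> z))\<^sup>2) > 0"
      using a bound[OF that] by (simp add: abs_square_less_1)
    then have "(cmod (\<psi> z - a))\<^sup>2 < (cmod (1 - cnj a * \<psi> z))\<^sup>2"
      using ident[of "\<psi> z"] by linarith
    then have "cmod (\<psi> z - a) < cmod (1 - cnj a * \<psi> z)"
      by (rule power2_less_imp_less) simp
    then show ?thesis
      using nz[OF that] by (simp add: q_def norm_divide)
  qed
  ultimately have q: "cmod (q z) \<le> cmod z" if "cmod z < 1" for z
    using Schwarz_Lemma(1) that by blast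
  show thesis
  \<comment> \<open>The square comes from the lower bound on the denominator \<open>D\<close>, the
    factor 2 from \<open>1 + s \<le> 2\<close>.\<close>
  proof (rule that[of "(1 - cmod a)\<^sup>2 / 2"])
    show "(1 - cmod a)\<^sup>2 / 2 > 0" using a by simp
    fix z :: complex assume z: "cmod z < 1"
    define D where "D = cmod (1 - cnj a * \<psi> z)"
    define r where "r = cmod z"
    define s where "s = cmod (\<psi> z)"
    have rs: "0 \<le> r" "r < 1" "0 \<le> s" "s < 1"
      using z bound by (auto simp: r_def s_def)
    have D: "1 - cmod a \<le> D" unfolding D_def using low bound z by blast
    have "cmod (\<psi> z - a) \<le> r * D"
      using q[OF z] nz[OF z] by (simp add: q_def D_def r_def norm_divide divide_simps)
    then have "(cmod (\<psi> z - a))\<^sup>2 \<le> (r * D)\<^sup>2"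
      by (intro power_mono) auto
    then have *: "(1 - r\<^sup>2) * D\<^sup>2 \<le> (1 - (cmod a)\<^sup>2) * (1 - s\<^sup>2)"
      using ident[of "\<psi> z"] by (simp add: D_def s_def power_mult_distrib algebra_simps)
    have "(1 - cmod a)\<^sup>2 * (1 - r) \<le> D\<^sup>2 * (1 - r\<^sup>2)"
      using D a rs by (intro mult_mono power_mono) (auto simp: power2_eq_square mult_left_le)
    also have "\<dots> \<le> (1 - (cmod a)\<^sup>2) * (1 - s\<^sup>2)"
      using * by (simp add: mult.commute)
    also have "\<dots> \<le> 1 - s\<^sup>2"
      using rs by (intro mult_left_le_one_le) (auto simp: a abs_square_le_1 power_le_one less_imp_le)
    also have "\<dots> = (1 + s) * (1 - s)"
      by (simp add: power2_eq_square algebra_simps)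
    also have "\<dots> \<le> 2 * (1 - s)"
      using rs by (intro mult_right_mono) auto
    finally show "(1 - cmod a)\<^sup>2 / 2 * (1 - cmod z) \<le> 1 - cmod (\<psi> z)"
      by (simp add: r_def s_def)
  qed
qed

text \<open>Differentiability of \<open>F'\<close> at \<open>x0\<close> gives a linear bound on
  \<open>F' y - F' x0\<close> near \<open>x0\<close>. The mean value inequality for the
  linearization then contributes the second factor \<open>norm (x - x0)\<close>.\<close>

lemma has_derivative_quadratic_remainder:
  fixes F :: "'a::real_normed_vector \<Rightarrow> 'b::real_normed_vector"
  assumes U: "open U" "x0 \<in> U"
    and F: "\<And>x. x \<in> U \<Longrightarrow> (F has_derivative blinfun_apply (F' x)) (at x)"
    and F': "(F' has_derivative F'') (at x0)"
  obtains M d where "d > 0" and "M \<ge> 0"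
    and "\<And>x. norm (x - x0) < d \<Longrightarrow> norm (F x - F x0 - F' x0 (x - x0)) \<le> M * (norm (x - x0))\<^sup>2"
proof -
  obtain B where B: "\<And>h. norm (F'' h) \<le> norm h * B"
    using bounded_linear.pos_bounded[OF has_derivative_bounded_linear[OF F']] by metis
  obtain d1 where d1: "d1 > 0" "\<And>y. norm (y - x0) < d1 \<Longrightarrow>
      norm (F' y - F' x0 - F'' (y - x0)) \<le> 1 * norm (y - x0)"
    using F' unfolding has_derivative_at_alt by (metis zero_less_one)
  obtain d2 where d2: "d2 > 0" "ball x0 d2 \<subseteq> U"
    using U open_contains_ball by blast
  have lip: "norm (F' y - F' x0) \<le> (\<bar>B\<bar> + 1) * norm (y - x0)" if "norm (y - x0) < d1" for y
  proof -
    have "norm (F' y - F' x0) \<le> norm (F' y - F' x0 - F'' (y - x0)) + norm (F'' (y - x0))"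
      by (metis diff_add_cancel norm_triangle_ineq)
    also have "\<dots> \<le> norm (y - x0) + norm (y - x0) * B"
      using d1(2)[OF that] B by (intro add_mono) auto
    also have "\<dots> \<le> norm (y - x0) + norm (y - x0) * \<bar>B\<bar>"
      by (intro add_mono mult_left_mono) auto
    finally show ?thesis by (simp add: algebra_simps)
  qed
  show thesis
  proof (rule that[of "min d1 d2" "\<bar>B\<bar> + 1"])
    fix x assume x: "norm (x - x0) < min d1 d2"
    let ?S = "cball x0 (norm (x - x0))"
    have "norm (F x - F x0 - F' x0 (x - x0)) \<le> norm (x - x0) * ((\<bar>B\<bar> + 1) * norm (x - x0))"
    proof (rule differentiable_bound_linearization[where S = ?S and f' = "\<lambda>y. blinfun_apply (F' y)"])
      show "x0 + t *\<^sub>R (x - x0) \<in> ?S" if "t \<in> {0..1}" for t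
        using that by (simp add: dist_norm mult_left_le_one_le)
      fix y assume y: "y \<in> ?S"
      then have y': "norm (y - x0) \<le> norm (x - x0)" by (simp add: dist_norm norm_minus_commute)
      then show "(F has_derivative blinfun_apply (F' y)) (at y within ?S)"
        using F[of y] d2(2) x by (auto simp: subset_iff dist_norm norm_minus_commute intro!: has_derivative_at_withinI)
      have "onorm (blinfun_apply (F' y) - blinfun_apply (F' x0)) = norm (F' y - F' x0)"
        by (simp add: norm_blinfun.rep_eq minus_blinfun.rep_eq fun_diff_def)
      also have "\<dots> \<le> (\<bar>B\<bar> + 1) * norm (x - x0)"
        using lip[of y] x y' by (smt (verit) mult_left_mono)
      finally show "onorm (blinfun_apply (F' y) - blinfun_apply (F' x0)) \<le> (\<bar>B\<bar> + 1) * norm (x - x0)" .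
    qed auto
    then show "norm (F x - F x0 - F' x0 (x - x0)) \<le> (\<bar>B\<bar> + 1) * (norm (x - x0))\<^sup>2"
      by (simp add: power2_eq_square mult_ac)
  qed (use d1 d2 in auto)
qed

section \<open>Boundary behaviour of an embedding map\<close>

lemma embedding_map_norm_less_1:
  assumes "embedding_map f" and "cmod z < 1"
  shows "norm (f z) < 1"
proof -
  have "f ` ball 0 1 \<subseteq> ball 0 1"
    using assms(1) unfolding embedding_map_def DA_variety_def by auto
  moreover have "z \<in> ball 0 1" using assms(2) by simp
  ultimately have "f z \<in> ball 0 1" by blast
  then show ?thesis by simp
qed

text \<open>At a boundary point the radial derivative pairs with the point to a positive real number:
  real because the boundary circle is mapped into the sphere, positive by the Hopf-type bound
  from the Schwarz lemma. Rescaling the radial parameter normalizes this number to 1.\<close>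
lemma embedding_map_radial_expansion:
  fixes f :: "complex \<Rightarrow> complex^'n::finite"
  assumes emb: "embedding_map f" and \<xi>: "cmod \<xi> = 1"
  obtains a u M t0 where "a > 0" and "t0 > 0" and "M \<ge> 0" and "cinner u (f \<xi>) = 1"
    and "a * t0 \<le> 1"
    and "\<And>t. 0 < t \<Longrightarrow> t < t0 \<Longrightarrow> norm (f ((1 - a * t) *\<^sub>R \<xi>) - f \<xi> + t *\<^sub>R u) \<le> M * t\<^sup>2"
proof -
  have holo: "\<And>i. (\<lambda>z. f z $ i) holomorphic_on ball 0 1"
    and sphere: "\<And>x. x \<in> cball 0 1 \<Longrightarrow> norm (f x) = 1 \<longleftrightarrow> cmod x = 1"
    using emb by (auto simp: embedding_map_def)
  obtain U F where U: "open U" "cball 0 1 \<subseteq> U" and C2: "C2_on U F"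
    and Ff: "\<And>x. x \<in> cball 0 1 \<Longrightarrow> F x = f x"
    using emb unfolding embedding_map_def by blast
  obtain F' F'' where F': "\<And>x. x \<in> U \<Longrightarrow> (F has_derivative blinfun_apply (F' x)) (at x)"
    and F'': "\<And>x. x \<in> U \<Longrightarrow> (F' has_derivative blinfun_apply (F'' x)) (at x)"
    using C2 unfolding C2_on_def by blast
  define p where "p = f \<xi>"
  define u where "u = F' \<xi> \<xi>"
  have \<xi>U: "\<xi> \<in> U" using U \<xi> by auto
  have p: "F \<xi> = p" "norm p = 1"
    using Ff sphere \<xi> by (auto simp: p_def)
  \<comment> \<open>At \<open>\<xi>\<close> itself no holomorphy is available. The Cauchy-Riemann
    relation holds inside the disc, where \<open>F\<close> and \<open>f\<close> agree, and passes to
    the boundary by continuity of \<open>F'\<close>.\<close>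
  have clin: "F' \<xi> (\<i> * \<xi>) $ j = \<i> * F' \<xi> \<xi> $ j" for j
  proof -
    have zero: "F' x (\<i> * \<xi>) $ j - \<i> * F' x \<xi> $ j = 0" if x: "x \<in> ball 0 1" for x
    proof -
      have xU: "x \<in> U" using x U(2) by auto
      have "(\<lambda>z. f z $ j) field_differentiable at x"
        using holo[of j] x holomorphic_on_imp_differentiable_at by blast
      then obtain D where "((\<lambda>z. f z $ j) has_field_derivative D) (at x)"
        by (auto simp: field_differentiable_def)
      then have "((\<lambda>z. F z $ j) has_derivative (\<lambda>h. D * h)) (at x)"
        unfolding has_field_derivative_def
        using x Ff by (rule_tac has_derivative_transform_within_open[of _ _ _ UNIV "ball 0 1"]) auto
      moreover have "((\<lambda>z. F z $ j) has_derivative (\<lambda>h. F' x h $ j)) (at x)"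
        using F'[OF xU] by (intro bounded_linear.has_derivative[OF bounded_linear_vec_nth]) auto
      ultimately have "(\<lambda>h. D * h) = (\<lambda>h. F' x h $ j)"
        by (rule has_derivative_unique)
      then show ?thesis by (metis cancel_comm_monoid_add_class.diff_cancel mult.left_commute)
    qed
    have "continuous_on U F'"
      using F'' by (auto intro!: continuous_at_imp_continuous_on has_derivative_continuous)
    then have cont: "continuous_on (closure (ball 0 1)) (\<lambda>x. F' x (\<i> * \<xi>) $ j - \<i> * F' x \<xi> $ j)"
      using U(2) by (auto intro!: continuous_intros elim: continuous_on_subset)
    have "\<xi> \<in> closure (ball 0 1)" using \<xi> by simp
    from continuous_constant_on_closure[OF cont zero this]
    have "F' \<xi> (\<i> * \<xi>) $ j - \<i> * F' \<xi> \<xi> $ j = 0" .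
    then show ?thesis by simp
  qed
  have tangent: "Im (cinner u p) = 0"
  proof -
    \<comment> \<open>Along this rotation of \<open>\<xi>\<close> the values of \<open>F\<close>
      stay on the sphere, so the velocity \<open>\<i> * u\<close> is real-orthogonal to
      \<open>p\<close>. This says that \<open>\<i> * cinner u p\<close> has real part zero.\<close>
    define \<gamma> :: "real \<Rightarrow> complex" where "\<gamma> = (\<lambda>\<theta>. exp (\<theta> *\<^sub>R \<i>) * \<xi>)"
    have norm\<gamma>: "cmod (\<gamma> \<theta>) = 1" for \<theta>
      using \<xi> by (simp add: \<gamma>_def norm_mult)
    have \<gamma>0: "\<gamma> 0 = \<xi>" by (simp add: \<gamma>_def)
    have "(\<gamma> has_derivative (\<lambda>h. h *\<^sub>R (\<i> * \<xi>))) (at 0)"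
      using has_vector_derivative_mult_left[OF exp_scaleR_has_vector_derivative_right[of \<i> 0 UNIV], of \<xi>]
      by (simp add: \<gamma>_def has_vector_derivative_def)
    then have "((\<lambda>\<theta>. F (\<gamma> \<theta>)) has_derivative (\<lambda>h. F' \<xi> (h *\<^sub>R (\<i> * \<xi>)))) (at 0)"
      using has_derivative_compose[of \<gamma> _ 0 UNIV F "F' \<xi>"] F'[OF \<xi>U] \<gamma>0 by simp
    then have "((\<lambda>\<theta>. F (\<gamma> \<theta>) \<bullet> F (\<gamma> \<theta>)) has_derivative
        (\<lambda>h. p \<bullet> F' \<xi> (h *\<^sub>R (\<i> * \<xi>)) + F' \<xi> (h *\<^sub>R (\<i> * \<xi>)) \<bullet> p)) (at 0)"
      using has_derivative_inner[of "\<lambda>\<theta>. F (\<gamma> \<theta>)" _ 0 UNIV "\<lambda>\<theta>. F (\<gamma> \<theta>)"] \<gamma>0 p(1) by simp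
    moreover have "F (\<gamma> \<theta>) \<bullet> F (\<gamma> \<theta>) = 1" for \<theta>
      using norm\<gamma>[of \<theta>] Ff sphere by (simp add: norm_eq_1[symmetric])
    ultimately have "((\<lambda>\<theta>. 1 :: real) has_derivative
        (\<lambda>h. p \<bullet> F' \<xi> (h *\<^sub>R (\<i> * \<xi>)) + F' \<xi> (h *\<^sub>R (\<i> * \<xi>)) \<bullet> p)) (at (0::real))" by simp
    then have "(\<lambda>h::real. p \<bullet> F' \<xi> (h *\<^sub>R (\<i> * \<xi>)) + F' \<xi> (h *\<^sub>R (\<i> * \<xi>)) \<bullet> p) = (\<lambda>h. 0)"
      by (rule has_derivative_unique) simp
    from fun_cong[OF this, of 1] have "F' \<xi> (\<i> * \<xi>) \<bullet> p = 0"
      by (simp add: inner_commute)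
    moreover have "cinner (F' \<xi> (\<i> * \<xi>)) p = \<i> * cinner u p"
      by (simp add: cinner_def clin u_def sum_distrib_left mult.assoc)
    ultimately show ?thesis by (simp add: Re_cinner[symmetric])
  qed
  obtain M d where d: "d > 0" and M: "M \<ge> 0"
    and quad: "\<And>x. norm (x - \<xi>) < d \<Longrightarrow> norm (F x - F \<xi> - F' \<xi> (x - \<xi>)) \<le> M * (norm (x - \<xi>))\<^sup>2"
    using has_derivative_quadratic_remainder[OF U(1) \<xi>U F' F''[OF \<xi>U]] by blast
  have quad': "norm (f ((1 - t) *\<^sub>R \<xi>) - p + t *\<^sub>R u) \<le> M * t\<^sup>2" if "0 < t" "t < min d 1" for t
  proof -
    have eq: "(1 - t) *\<^sub>R \<xi> - \<xi> = - (t *\<^sub>R \<xi>)" by (simp add: algebra_simps)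
    have "(1 - t) *\<^sub>R \<xi> \<in> cball 0 1" using that \<xi> by simp
    then show ?thesis
      using quad[of "(1 - t) *\<^sub>R \<xi>"] that \<xi> Ff[of "(1 - t) *\<^sub>R \<xi>"]
      unfolding eq by (simp add: p u_def blinfun.minus_right blinfun.scaleR_right)
  qed
  define A where "A = Re (cinner u p)"
  have uA: "cinner u p = of_real A"
    using tangent by (simp add: A_def complex_eq_iff)
  have pp: "cinner p p = 1"
    using p(2) by (simp add: cinner_self)
  have "A > 0"
  proof (rule ccontr)
    assume "\<not> A > 0"
    define \<psi> where "\<psi> = (\<lambda>z. cinner (f z) p)"
    have "\<psi> holomorphic_on ball 0 1"
      unfolding \<psi>_def cinner_def by (intro holomorphic_intros holo)
    moreover have "cmod (\<psi> z) < 1" if "cmod z < 1" for z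
      using norm_cinner_le[of "f z" p] embedding_map_norm_less_1[OF emb that] p(2) by (simp add: \<psi>_def)
    ultimately obtain c where c: "c > 0" "\<And>z. cmod z < 1 \<Longrightarrow> c * (1 - cmod z) \<le> 1 - cmod (\<psi> z)"
      using Schwarz_Pick_boundary_growth by blast
    \<comment> \<open>Small enough for the quadratic expansion and for
      \<open>M * t \<le> c / 2\<close>.\<close>
    define t where "t = min (min d 1 / 2) (c / (2 * (M + 1)))"
    have t: "0 < t" "t < min d 1" "t < 1"
      using d c(1) M by (auto simp: t_def min_less_iff_disj)
    define r where "r = f ((1 - t) *\<^sub>R \<xi>) - p + t *\<^sub>R u"
    have "cmod (cinner r p) \<le> M * t\<^sup>2"
      using norm_cinner_le[of r p] quad'[OF t(1,2)] p(2) by (simp add: r_def)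
    moreover have "\<psi> ((1 - t) *\<^sub>R \<xi>) = 1 - of_real (t * A) + cinner r p"
      by (simp add: \<psi>_def r_def cinner_add_left cinner_diff_left cinner_scaleR_left pp uA scaleR_conv_of_real[where 'a = complex])
    ultimately have "Re (\<psi> ((1 - t) *\<^sub>R \<xi>)) \<ge> 1 - t * A - M * t\<^sup>2"
      using abs_Re_le_cmod[of "cinner r p"] by simp
    moreover have "c * t \<le> 1 - cmod (\<psi> ((1 - t) *\<^sub>R \<xi>))"
      using c(2)[of "(1 - t) *\<^sub>R \<xi>"] t \<xi> by simp
    ultimately have "c * t \<le> t * A + M * t\<^sup>2"
      using complex_Re_le_cmod[of "\<psi> ((1 - t) *\<^sub>R \<xi>)"] by linarith
    then have "t * c \<le> t * (A + M * t)"
      by (simp add: power2_eq_square algebra_simps)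
    then have "c \<le> A + M * t" using t(1) by simp
    moreover have "M * t \<le> (M + 1) * (c / (2 * (M + 1)))"
      using M t(1) by (intro mult_mono) (auto simp: t_def)
    moreover have "(M + 1) * (c / (2 * (M + 1))) = c / 2"
      using M by (simp add: field_simps)
    ultimately show False
      using c(1) \<open>\<not> A > 0\<close> by linarith
  qed
  show thesis
  \<comment> \<open>Replacing \<open>t\<close> by \<open>t / A\<close> normalizes the pairing to 1.
    The range \<open>A * min d 1\<close> keeps \<open>t / A\<close> below 1, so the radial point
    does not cross the origin.\<close>
  proof (rule that[of "1 / A" "A * min d 1" "M / A\<^sup>2" "(1 / A) *\<^sub>R u"])
    fix t assume t: "0 < t" "t < A * min d 1"
    have "t / A < min d 1"
      unfolding pos_divide_less_eq[OF \<open>A > 0\<close>] using t(2) by (simp only: mult.commute)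
    then have "norm (f ((1 - t / A) *\<^sub>R \<xi>) - p + (t / A) *\<^sub>R u) \<le> M * (t / A)\<^sup>2"
      using t(1) \<open>A > 0\<close> by (intro quad') simp_all
    then show "norm (f ((1 - 1 / A * t) *\<^sub>R \<xi>) - f \<xi> + t *\<^sub>R (1 / A) *\<^sub>R u) \<le> M / A\<^sup>2 * t\<^sup>2"
      by (simp add: p_def power_divide)
  qed (use \<open>A > 0\<close> d M uA in \<open>auto simp: cinner_scaleR_left p_def scaleR_conv_of_real[where 'a = complex]\<close>)
qed

section \<open>Kernel asymptotics near the common boundary point\<close>

text \<open>Both points approach \<open>p\<close> at the normalized speed, so to first order the kernel does not
  see from which side.\<close>
lemma DA_kernel_radial_estimate:
  fixes x y p u v :: "complex^'n::finite"
  assumes p: "norm p = 1" and u: "cinner u p = 1" "norm u \<le> N" and v: "cinner v p = 1" "norm v \<le> N"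
    and x: "norm (x - p + t *\<^sub>R u) \<le> M * t\<^sup>2" and y: "norm (y - p + t *\<^sub>R v) \<le> M * t\<^sup>2"
    and M: "M \<ge> 0" and t: "0 < t" "t \<le> 1" and K: "K = N\<^sup>2 + (2 + 2 * N + M) * M" "K * t \<le> 1"
  shows "cmod (DA_kernel x y - of_real (1 / (2 * t))) \<le> K / 2"
proof -
  define r where "r = x - p + t *\<^sub>R u"
  define s where "s = y - p + t *\<^sub>R v"
  have N: "N \<ge> 0" using u(2) norm_ge_zero order_trans by blast
  have pp: "cinner p p = 1" using p by (simp add: cinner_self)
  have pv: "cinner p v = 1" using cnj_cinner[of v p] v(1) by simp
  have t2: "t\<^sup>2 \<le> 1" using t by (simp add: power_le_one)
  have tN: "norm (t *\<^sub>R u) \<le> N" "norm (t *\<^sub>R v) \<le> N"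
    using t mult_mono[OF t(2) u(2)] mult_mono[OF t(2) v(2)] by simp_all
  have Mt: "M * t\<^sup>2 \<le> M" using M t2 by (simp add: mult_left_le)
  have nx: "norm (p - t *\<^sub>R u) \<le> 1 + N"
    using norm_triangle_ineq4[of p "t *\<^sub>R u"] p tN by linarith
  have "y = (p - t *\<^sub>R v) + s" by (simp add: s_def)
  then have ny: "norm y \<le> 1 + N + M"
    using norm_triangle_ineq[of "p - t *\<^sub>R v" s] norm_triangle_ineq4[of p "t *\<^sub>R v"] p tN y Mt
    by (simp add: s_def)
  have "cmod (cinner u v) \<le> N * N"
    using norm_cinner_le[of u v] mult_mono[OF u(2) v(2) N] by simp
  then have 1: "cmod (t\<^sup>2 *\<^sub>R cinner u v) \<le> t\<^sup>2 * N\<^sup>2"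
    by (simp add: power2_eq_square mult_left_mono)
  have 2: "cmod (cinner r y) \<le> (M * t\<^sup>2) * (1 + N + M)"
    using norm_cinner_le[of r y] mult_mono[OF x ny] M by (simp add: r_def)
  have 3: "cmod (cinner (p - t *\<^sub>R u) s) \<le> (1 + N) * (M * t\<^sup>2)"
    using norm_cinner_le[of "p - t *\<^sub>R u" s] mult_mono[OF nx y] N by (simp add: s_def)
  \<comment> \<open>The remainder \<open>r\<close> is split off against the full \<open>y\<close>,
    then \<open>s\<close> against \<open>p - t *\<^sub>R u\<close>. Three second-order errors
    remain, and their bounds add up to \<open>K\<close> times the square of
    \<open>t\<close>.\<close>
  have "cinner x y = cinner r y + cinner (p - t *\<^sub>R u) y"
    by (simp add: cinner_add_left[symmetric] r_def)
  also have "cinner (p - t *\<^sub>R u) y = cinner (p - t *\<^sub>R u) s + cinner (p - t *\<^sub>R u) (p - t *\<^sub>R v)"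
    by (simp add: cinner_add_right[symmetric] s_def)
  also have "cinner (p - t *\<^sub>R u) (p - t *\<^sub>R v) = 1 - of_real (2 * t) + t\<^sup>2 *\<^sub>R cinner u v"
    by (simp add: cinner_diff_left cinner_diff_right cinner_scaleR_left cinner_scaleR_right
        pp pv u(1) scaleR_conv_of_real[where 'a = complex] power2_eq_square algebra_simps)
  finally have "1 - cinner x y - of_real (2 * t)
      = - (t\<^sup>2 *\<^sub>R cinner u v + cinner r y + cinner (p - t *\<^sub>R u) s)" by simp
  then have "cmod (1 - cinner x y - of_real (2 * t))
      = cmod (t\<^sup>2 *\<^sub>R cinner u v + cinner r y + cinner (p - t *\<^sub>R u) s)"
    by (simp only: norm_minus_cancel)
  also have "\<dots> \<le> t\<^sup>2 * N\<^sup>2 + (M * t\<^sup>2) * (1 + N + M) + (1 + N) * (M * t\<^sup>2)"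
    by (intro order_trans[OF norm_triangle_ineq] add_mono 1 2 3)
  also have "\<dots> = K * t\<^sup>2"
    by (simp add: K(1) algebra_simps)
  finally have *: "cmod (1 - cinner x y - of_real (2 * t)) \<le> K * t\<^sup>2" .
  define D where "D = 1 - cinner x y"
  have "K * t\<^sup>2 \<le> t"
    using mult_right_mono[OF K(2), of t] t by (simp add: power2_eq_square mult.assoc)
  \<comment> \<open>The condition \<open>K * t \<le> 1\<close> makes the error at most
    \<open>t\<close>, half of the main term \<open>2 * t\<close>. The reciprocal therefore has a
    bounded error although it blows up.\<close>
  then have D: "cmod D \<ge> t"
    using * norm_triangle_ineq2[of "of_real (2 * t)" "of_real (2 * t) - D"] t
    by (simp add: D_def norm_minus_commute)
  then have D0: "D \<noteq> 0" using t by auto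
  have "DA_kernel x y - of_real (1 / (2 * t)) = - (D - of_real (2 * t)) / (D * of_real (2 * t))"
    using D0 t by (simp add: DA_kernel_def D_def[symmetric] field_simps)
  then have "cmod (DA_kernel x y - of_real (1 / (2 * t))) = cmod (D - of_real (2 * t)) / (cmod D * (2 * t))"
    using t by (simp only: norm_divide norm_mult norm_minus_cancel norm_of_real)
  also have "\<dots> \<le> (K * t\<^sup>2) / (t * (2 * t))"
    using * D t order_trans[OF norm_ge_zero *] by (intro frac_le mult_mono) (auto simp: D_def)
  also have "\<dots> = K / 2"
    using t by (simp add: power2_eq_square)
  finally show ?thesis .
qed

section \<open>The limit along the two radii\<close>

theorem theorem2p3:
  fixes f :: "complex \<Rightarrow> complex^'n::finite"
    and h g :: "complex \<Rightarrow> complex"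
    and \<xi> \<zeta> :: complex
  assumes "embedding_map f"
    and "cmod \<xi> = 1" and "cmod \<zeta> = 1" and "\<xi> \<noteq> \<zeta>"
    and "f \<xi> = f \<zeta>"
    and "in_Hf f h"
    and "continuous_on (cball 0 1) g" and "\<forall>z\<in>ball 0 1. g z = h z"
  shows "g \<xi> = g \<zeta>"
proof -
  define p where "p = f \<xi>"
  have p\<zeta>: "f \<zeta> = p" using assms(5) by (simp add: p_def)
  have p: "norm p = 1"
    using assms(1,2) by (auto simp: embedding_map_def p_def)
  obtain a u M1 t1 where a: "a > 0" "t1 > 0" "M1 \<ge> 0" "cinner u p = 1" "a * t1 \<le> 1"
    and fa: "\<And>t. 0 < t \<Longrightarrow> t < t1 \<Longrightarrow> norm (f ((1 - a * t) *\<^sub>R \<xi>) - p + t *\<^sub>R u) \<le> M1 * t\<^sup>2"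
    unfolding p_def by (rule embedding_map_radial_expansion[OF assms(1,2)]) blast
  obtain b v M2 t2 where b: "b > 0" "t2 > 0" "M2 \<ge> 0" "cinner v p = 1" "b * t2 \<le> 1"
    and fb: "\<And>t. 0 < t \<Longrightarrow> t < t2 \<Longrightarrow> norm (f ((1 - b * t) *\<^sub>R \<zeta>) - p + t *\<^sub>R v) \<le> M2 * t\<^sup>2"
    unfolding p\<zeta>[symmetric] by (rule embedding_map_radial_expansion[OF assms(1,3)]) blast
  define M where "M = max M1 M2"
  define N where "N = max (norm u) (norm v)"
  define K where "K = N\<^sup>2 + (2 + 2 * N + M) * M"
  have M: "M \<ge> 0" using a(3) by (simp add: M_def max_def)
  have N: "N \<ge> 0" by (simp add: N_def le_max_iff_disj)
  have K: "K \<ge> 0" using M N by (simp add: K_def)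
  \<comment> \<open>The bound \<open>1 / (K + 1)\<close> secures both \<open>t \<le> 1\<close> and
    \<open>K * t \<le> 1\<close>.\<close>
  define t0 where "t0 = min (min t1 t2) (1 / (K + 1))"
  have t0: "t0 > 0" using a b K by (simp add: t0_def)
  \<comment> \<open>The shift by 2 makes \<open>t n < t0\<close> strict already at
    \<open>n = 0\<close>.\<close>
  define t where "t = (\<lambda>n. t0 / real (n + 2))"
  have t: "0 < t n" "t n < t1" "t n < t2" "t n \<le> 1" "K * t n \<le> 1" for n
  proof -
    show pos: "0 < t n" using t0 by (simp add: t_def)
    have "t n < t0" using t0 by (simp add: t_def field_simps add_pos_nonneg)
    then have less: "t n < t1" "t n < t2" "t n < 1 / (K + 1)" by (auto simp: t0_def)
    then show "t n < t1" "t n < t2" by auto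
    have "t n * (K + 1) < 1" using less(3) K by (simp add: field_simps)
    moreover have "t n * K \<ge> 0" using pos K by simp
    ultimately show "t n \<le> 1" "K * t n \<le> 1" using pos by (auto simp: algebra_simps)
  qed
  have t_lim: "t \<longlonglongrightarrow> 0"
    unfolding t_def using LIMSEQ_ignore_initial_segment[OF lim_const_over_n, of t0 2] by simp
  define z where "z = (\<lambda>n. (1 - a * t n) *\<^sub>R \<xi>)"
  define w where "w = (\<lambda>n. (1 - b * t n) *\<^sub>R \<zeta>)"
  have z: "cmod (z n) < 1" for n
  proof -
    have "a * t n < 1" using t(2)[of n] a(1,5) by (smt (verit) mult_strict_left_mono)
    then show ?thesis using a(1) t(1)[of n] assms(2) by (simp add: z_def)
  qed
  have w: "cmod (w n) < 1" for n
  proof -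
    have "b * t n < 1" using t(3)[of n] b(1,5) by (smt (verit) mult_strict_left_mono)
    then show ?thesis using b(1) t(1)[of n] assms(3) by (simp add: w_def)
  qed
  have z_lim: "z \<longlonglongrightarrow> \<xi>" and w_lim: "w \<longlonglongrightarrow> \<zeta>"
    unfolding z_def w_def by (auto intro!: tendsto_eq_intros t_lim)
  have fz: "norm (f (z n) - p + t n *\<^sub>R u) \<le> M * (t n)\<^sup>2" for n
    unfolding z_def by (rule order_trans[OF fa[OF t(1) t(2)]]) (simp add: M_def mult_right_mono)
  have fw: "norm (f (w n) - p + t n *\<^sub>R v) \<le> M * (t n)\<^sup>2" for n
    unfolding w_def by (rule order_trans[OF fb[OF t(1) t(3)]]) (simp add: M_def mult_right_mono)
  obtain U F where UF: "cball 0 1 \<subseteq> U" "C2_on U F" "\<And>x. x \<in> cball 0 1 \<Longrightarrow> F x = f x"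
    using assms(1) unfolding embedding_map_def by blast
  have "continuous_on (cball 0 1) F"
    using UF(1,2) unfolding C2_on_def
    by (intro continuous_at_imp_continuous_on ballI) (metis has_derivative_continuous subsetD)
  then have f_cont: "continuous_on (cball 0 1) f"
    using UF(3) by (rule continuous_on_eq)
  have fz_lim: "(\<lambda>n. f (z n)) \<longlonglongrightarrow> p" and fw_lim: "(\<lambda>n. f (w n)) \<longlonglongrightarrow> p"
    and gz_lim: "(\<lambda>n. g (z n)) \<longlonglongrightarrow> g \<xi>" and gw_lim: "(\<lambda>n. g (w n)) \<longlonglongrightarrow> g \<zeta>"
    using continuous_on_tendsto_compose[OF f_cont z_lim] continuous_on_tendsto_compose[OF f_cont w_lim]
      continuous_on_tendsto_compose[OF assms(7) z_lim] continuous_on_tendsto_compose[OF assms(7) w_lim]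
      z w assms(2,3) by (auto simp: p_def p\<zeta>[unfolded p_def] less_imp_le)
  define k where "k = (\<lambda>z w. DA_kernel (f z) (f w))"
  \<comment> \<open>Pairing each point with its own direction treats all four kernel values at
    once.\<close>
  have est: "cmod (DA_kernel x y - of_real (1 / (2 * t n))) \<le> K / 2"
    if "(x, u') \<in> {(f (z n), u), (f (w n), v)}" "(y, v') \<in> {(f (z n), u), (f (w n), v)}" for x y u' v' n
    using that fz[of n] fw[of n] p a(4) b(4) M t[of n] K_def
    by (intro DA_kernel_radial_estimate[where p = p and u = u' and v = v' and M = M and N = N])
      (auto simp: N_def)
  have "g \<xi> - g \<zeta> = 0"
  proof (rule in_rkhs_diff_limit_zero)
    show "in_rkhs (ball 0 1) k h"
      using assms(6) by (simp add: in_Hf_def k_def DA_kernel_def)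
    show "k y x = cnj (k x y)" for x y
      by (simp add: k_def DA_kernel_def cnj_cinner)
    show "z n \<in> ball 0 1" "w n \<in> ball 0 1" for n using z w by simp_all
    show "cmod (k (z n) (z n) - k (z n) (w n) - k (w n) (z n) + k (w n) (w n)) \<le> 2 * K" for n
    proof -
      \<comment> \<open>The common singular part \<open>c\<close> cancels in the alternating sum and
        leaves four errors of size at most \<open>K / 2\<close>.\<close>
      define c where "c = complex_of_real (1 / (2 * t n))"
      have "k (z n) (z n) - k (z n) (w n) - k (w n) (z n) + k (w n) (w n)
        = ((k (z n) (z n) - c) - (k (z n) (w n) - c)) - ((k (w n) (z n) - c) - (k (w n) (w n) - c))"
        by simp
      also have "cmod \<dots> \<le> (K / 2 + K / 2) + (K / 2 + K / 2)"
        unfolding c_def k_def by (intro order_trans[OF norm_triangle_ineq4] add_mono est) auto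
      finally show ?thesis by simp
    qed
    show "(\<lambda>n. k x (z n) - k x (w n)) \<longlonglongrightarrow> 0" if "x \<in> ball 0 1" for x
    proof -
      have "1 - cinner (f x) p \<noteq> 0"
        using cinner_neq_1[of "f x" p] embedding_map_norm_less_1[OF assms(1), of x] that p by auto
      \<comment> \<open>Both limits are the same number because \<open>f\<close> takes the value
        \<open>p\<close> at \<open>\<xi>\<close> and at \<open>\<zeta>\<close>.\<close>
      then have "(\<lambda>n. k x (z n) - k x (w n)) \<longlonglongrightarrow> 1 / (1 - cinner (f x) p) - 1 / (1 - cinner (f x) p)"
        unfolding k_def DA_kernel_def
        by (intro tendsto_intros bounded_bilinear.tendsto[OF bounded_bilinear_cinner] fz_lim fw_lim)
      then show ?thesis by simp
    qed
    show "(\<lambda>n. h (z n) - h (w n)) \<longlonglongrightarrow> g \<xi> - g \<zeta>"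
      using tendsto_diff[OF gz_lim gw_lim] assms(8) z w by simp
  qed
  then show ?thesis by simp
qed

end
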